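(* Let $k_1,k_2\ge1$ be integers. For all $n\ge1$, $$P_{q,\theta}\big(L_n^{(1)}\le k_1,\ L_n^{(0)}\le k_2\big)=\sum_{i=1}^{n}\theta^{n-i}\prod_{j=1}^{i}(1-\theta q^{j-1})\sum_{s=1}^{i}\Big[D_q^{k_1+1,k_2+1}(n-i,i,s)+A_q^{k_1+1,k_2+1}(n-i,i,s)+C_q^{k_1+1,k_2+1}(n-i,i,s+1)+B_q^{k_1+1,k_2+1}(n-i,i,s)\Big]+\eta(n,k_1)\theta^n,$$ where $\eta(n,k_1)=1$ if $n\le k_1$ and $\eta(n,k_1)=0$ otherwise.
   Context: Model: fix reals $0\le\theta\le1$ and $0<q<1$. $(X_j)_{j\ge1}$ is a sequence of $\{0,1\}$-valued random variables (1 = success, 0 = failure) with law $P_{q,\theta}$ such that, conditionally on $X_1,\dots,X_{j-1}$ containing exactly $i-1$ zeros, $X_j=0$ with probability $1-\theta q^{i-1}$ and $X_j=1$ with probability $\theta q^{i-1}$. Conventions: $0^0=1$, empty products are 1, empty sums are 0. $L_n^{(1)}$ and $L_n^{(0)}$ are the lengths of the longest run of consecutive successes and of consecutive failures, respectively, in $X_1,\dots,X_n$ ($0$ if there is none). Combinatorial sums, for positive integers $\kappa_1,\kappa_2$ (the superscripts), integers $m,r$ and $s\ge1$, where all $x_j,y_j$ are integers with $0<x_j<\kappa_1$, $0<y_j<\kappa_2$, $\sum x_j=m$, $\sum y_j=r$ (a family of zero variables consists of the single empty tuple, whose sum is $0$): - $A_q^{\kappa_1,\kappa_2}(m,r,s)=\sum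 q^{\sum_{j=1}^{s-1}(y_1+\dots+y_j)x_j}$ over $(x_1,\dots,x_{s-1})$, $(y_1,\dots,y_s)$; - $B_q^{\kappa_1,\kappa_2}(m,r,s)=\sum q^{\sum_{j=2}^{s}(y_1+\dots+y_{j-1})x_j}$ over $(x_1,\dots,x_s)$, $(y_1,\dots,y_s)$; - $C_q^{\kappa_1,\kappa_2}(m,r,s)=\sum q^{\sum_{j=2}^{s}(y_1+\dots+y_{j-1})x_j}$ over $(x_1,\dots,x_s)$, $(y_1,\dots,y_{s-1})$; - $D_q^{\kappa_1,\kappa_2}(m,r,s)=\sum q^{\sum_{j=1}^{s}(y_1+\dots+y_j)x_j}$ over $(x_1,\dots,x_s)$, $(y_1,\dots,y_s)$. *)

theory Defs
  imports "HOL-Probability.Probability"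
begin

text \<open>
  Indices of the process start at \<open>1\<close>; \<open>X 0\<close> is unconstrained. Conditioning is on every full history
  \<open>X 1 = x 1, \<dots>, X (j - 1) = x (j - 1)\<close> of positive probability. The number of zeros in the history
  plays the role of \<open>i - 1\<close>, and \<open>0 ^ 0 = 1\<close>.
\<close>

definition q_bernoulli_process :: "real \<Rightarrow> real \<Rightarrow> 'a measure \<Rightarrow> (nat \<Rightarrow> 'a \<Rightarrow> nat) \<Rightarrow> bool" where
  "q_bernoulli_process q \<theta> M X \<longleftrightarrow>
     prob_space M \<and>
     (\<forall>j\<ge>1. X j \<in> measurable M (count_space {0, 1})) \<and>
     (\<forall>j\<ge>1. \<forall>x :: nat \<Rightarrow> nat.
        \<P>(\<omega> in M. \<forall>l\<in>{1..<j}. X l \<omega> = x l) > 0 \<longrightarrow>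
        \<P>(\<omega> in M. X j \<omega> = 0 \<bar> \<forall>l\<in>{1..<j}. X l \<omega> = x l)
          = 1 - \<theta> * q ^ card {l \<in> {1..<j}. x l = 0} \<and>
        \<P>(\<omega> in M. X j \<omega> = 1 \<bar> \<forall>l\<in>{1..<j}. X l \<omega> = x l)
          = \<theta> * q ^ card {l \<in> {1..<j}. x l = 0})"

text \<open>Length of the longest run of the value \<open>v\<close> in \<open>x 1, \<dots>, x n\<close>; the choice \<open>l = 0\<close> is always admissible.\<close>

definition longest_run :: "'b \<Rightarrow> (nat \<Rightarrow> 'b) \<Rightarrow> nat \<Rightarrow> nat" where
  "longest_run v x n = Max {l. \<exists>a. a + l \<le> n \<and> (\<forall>j\<in>{a + 1..a + l}. x j = v)}"

text \<open>
  Tuples \<open>(x 1, \<dots>, x t)\<close> of integers with \<open>0 < x j < \<kappa>\<close> and sum \<open>m\<close>, as extensional functions on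
  \<open>{1..t}\<close>, so that there is exactly one tuple of length \<open>0\<close>.
\<close>

definition tuples :: "nat \<Rightarrow> nat \<Rightarrow> int \<Rightarrow> (nat \<Rightarrow> nat) set" where
  "tuples t \<kappa> m = {x \<in> {1..t} \<rightarrow>\<^sub>E {0<..<\<kappa>}. int (\<Sum>j=1..t. x j) = m}"

definition A_sum :: "real \<Rightarrow> nat \<Rightarrow> nat \<Rightarrow> int \<Rightarrow> int \<Rightarrow> nat \<Rightarrow> real" where
  "A_sum q \<kappa>1 \<kappa>2 m r s =
     (\<Sum>x\<in>tuples (s - 1) \<kappa>1 m. \<Sum>y\<in>tuples s \<kappa>2 r. q ^ (\<Sum>j=1..s - 1. (\<Sum>l=1..j. y l) * x j))"

definition B_sum :: "real \<Rightarrow> nat \<Rightarrow> nat \<Rightarrow> int \<Rightarrow> int \<Rightarrow> nat \<Rightarrow> real" where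
  "B_sum q \<kappa>1 \<kappa>2 m r s =
     (\<Sum>x\<in>tuples s \<kappa>1 m. \<Sum>y\<in>tuples s \<kappa>2 r. q ^ (\<Sum>j=2..s. (\<Sum>l=1..j - 1. y l) * x j))"

definition C_sum :: "real \<Rightarrow> nat \<Rightarrow> nat \<Rightarrow> int \<Rightarrow> int \<Rightarrow> nat \<Rightarrow> real" where
  "C_sum q \<kappa>1 \<kappa>2 m r s =
     (\<Sum>x\<in>tuples s \<kappa>1 m. \<Sum>y\<in>tuples (s - 1) \<kappa>2 r. q ^ (\<Sum>j=2..s. (\<Sum>l=1..j - 1. y l) * x j))"

definition D_sum :: "real \<Rightarrow> nat \<Rightarrow> nat \<Rightarrow> int \<Rightarrow> int \<Rightarrow> nat \<Rightarrow> real" where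
  "D_sum q \<kappa>1 \<kappa>2 m r s =
     (\<Sum>x\<in>tuples s \<kappa>1 m. \<Sum>y\<in>tuples s \<kappa>2 r. q ^ (\<Sum>j=1..s. (\<Sum>l=1..j. y l) * x j))"

definition eta :: "nat \<Rightarrow> nat \<Rightarrow> real" where
  "eta n k = (if n \<le> k then 1 else 0)"

end

theory Submission
  imports Defs
begin

text \<open>
  Call a sequence of successes and failures of length \<open>n\<close> a word. Under the process, a word with \<open>i\<close>
  failures has probability \<open>\<theta> ^ (n - i) * (\<Prod>j=1..i. 1 - \<theta> * q ^ (j - 1)) * q ^ e\<close>, where \<open>e\<close> counts
  the pairs of a success and an earlier failure: the \<open>j\<close>-th failure occurs after \<open>j - 1\<close> failures, and each
  success carries one factor \<open>q\<close> for each failure before it. If the word is cut into its runs, of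
  lengths \<open>x j\<close> (successes) and \<open>y j\<close> (failures), then \<open>e\<close> is the exponent in one of the sums \<open>A\<close>, \<open>B\<close>, \<open>C\<close>,
  \<open>D\<close>; which one depends on the first and the last letter. Words without failures are the case of \<open>eta\<close>.

  Rather than setting up a bijection between words and tuples of run lengths, the proof removes the
  last run on both sides and compares the recursions. For the sums, removing the last entry of a
  tuple turns \<open>D\<close> into \<open>A\<close>, \<open>A\<close> into \<open>D\<close>, \<open>C\<close> into \<open>B\<close> and \<open>B\<close> into \<open>C\<close>; grouped by the last letter, this gives
  the two mutually recursive identities \<open>success_ending_sum_rec\<close> and \<open>failure_ending_sum_rec\<close>. For the
  probabilities, let \<open>bounded_runs k v n i\<close> be the event that the runs in the first \<open>n\<close> letters obey the
  bounds, that \<open>i\<close> of these letters are failures, and that the last one is \<open>v\<close>. The conditional law of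
  the next letter depends only on the number of failures so far, so appending a run to an event on
  which this number is fixed multiplies the probability by an explicit factor
  (\<open>prob_event_append_run\<close>), and splitting by the length of the last run gives \<open>prob_bounded_runs_rec\<close>.
  Up to the factor that does not depend on the order of the letters these are the same recursions,
  whence \<open>prob_bounded_runs\<close>. The theorem follows by summing over the number of failures and the last
  letter.
\<close>

section \<open>Removing the last run in the combinatorial sums\<close>

lemma finite_tuples: "finite (tuples t \<kappa> m)"
  unfolding tuples_def by (rule finite_subset[OF _ finite_PiE[of "{1..t}" "\<lambda>_. {0<..<\<kappa>}"]]) auto

lemma tuples_0: "tuples 0 \<kappa> m = (if m = 0 then {\<lambda>_. undefined} else {})"
  by (auto simp: tuples_def)

lemma tuples_eq_empty_if_neg: "m < 0 \<Longrightarrow> tuples t \<kappa> m = {}"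
  by (auto simp: tuples_def simp del: of_nat_sum)

text \<open>
  All entries are positive, so a tuple of length \<open>t\<close> has sum at least \<open>t\<close>. This is what makes the
  range of \<open>s\<close> in the theorem harmless: a word with \<open>i\<close> failures has at most \<open>i\<close> failure runs.
\<close>

lemma tuples_eq_empty_if_long:
  assumes "m < int t"
  shows "tuples t \<kappa> m = {}"
proof -
  have "int t \<le> int (\<Sum>j=1..t. x j)" if "x \<in> {1..t} \<rightarrow>\<^sub>E {0<..<\<kappa>}" for x
  proof -
    have "(\<Sum>j=1..t. 1) \<le> (\<Sum>j=1..t. x j)"
      using that by (intro sum_mono) (force simp: PiE_iff)
    then show ?thesis by (simp del: of_nat_sum)
  qed
  then have "int t \<le> m" if "x \<in> tuples t \<kappa> m" for x
    using that unfolding tuples_def by blast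
  then show ?thesis using assms by (metis all_not_in_conv not_less)
qed

lemma sum_entries_tuple: "y \<in> tuples t \<kappa> r \<Longrightarrow> (\<Sum>l=1..t. y l) = nat r"
  by (auto simp: tuples_def simp del: of_nat_sum)

text \<open>
  Splitting off the last entry of a tuple. On words, this removes the last run of one of the two kinds.
\<close>

lemma sum_tuples_Suc:
  "(\<Sum>x\<in>tuples (Suc t) \<kappa> m. f x) =
   (\<Sum>a\<in>{0<..<\<kappa>}. \<Sum>x\<in>tuples t \<kappa> (m - int a). f (x(Suc t := a)))"
proof -
  have "(\<Sum>x\<in>tuples (Suc t) \<kappa> m. f x) =
        (\<Sum>(a, x)\<in>Sigma {0<..<\<kappa>} (\<lambda>a. tuples t \<kappa> (m - int a)). f (x(Suc t := a)))"
  proof (rule sum.reindex_bij_witness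
      [where j = "\<lambda>x. (x (Suc t), restrict x {1..t})" and i = "\<lambda>(a, x). x(Suc t := a)"], goal_cases)
    case (1 x)
    then show ?case by (auto simp: tuples_def PiE_iff extensional_def restrict_def fun_eq_iff le_Suc_eq)
  next
    case (2 x)
    have "(\<Sum>j=1..t. restrict x {1..t} j) = (\<Sum>j=1..t. x j)"
      by (rule sum.cong) auto
    with 2 show ?case by (auto simp: tuples_def PiE_iff)
  next
    case (3 b)
    then show ?case
      by (auto simp: tuples_def PiE_iff extensional_def restrict_def)
  next
    case (4 b)
    obtain a x where b: "b = (a, x)" by (cases b)
    have "(\<Sum>j=1..t. (x(Suc t := a)) j) = (\<Sum>j=1..t. x j)"
      by (rule sum.cong) auto
    with 4 show ?case
      by (auto simp: b tuples_def PiE_iff extensional_def le_Suc_eq)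
  next
    case (5 x)
    then have "(restrict x {1..t})(Suc t := x (Suc t)) = x"
      by (auto simp: tuples_def PiE_iff extensional_def restrict_def fun_eq_iff le_Suc_eq)
    then show ?case by simp
  qed
  also have "\<dots> = (\<Sum>a\<in>{0<..<\<kappa>}. \<Sum>x\<in>tuples t \<kappa> (m - int a). f (x(Suc t := a)))"
    by (rule sum.Sigma[symmetric]) (auto simp: finite_tuples)
  finally show ?thesis .
qed

text \<open>
  The four sums describe the words according to their first and last run: \<open>D\<close> and \<open>A\<close> are for words that
  start with a failure, \<open>C\<close> and \<open>B\<close> for words that start with a success; words of \<open>D\<close> and \<open>C\<close> end with a
  success, words of \<open>A\<close> and \<open>B\<close> with a failure. Removing the last run thus exchanges \<open>D\<close> with \<open>A\<close> and \<open>C\<close>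
  with \<open>B\<close>. A final success run of length \<open>a\<close> comes after all \<open>r\<close> failures, hence the factor
  \<open>q ^ (r * a)\<close>; a final failure run has no success after it and leaves the exponent unchanged.
\<close>

lemma D_sum_last_success_run:
  "D_sum q \<kappa>1 \<kappa>2 m r (Suc s) =
   (\<Sum>a\<in>{0<..<\<kappa>1}. q ^ (nat r * a) * A_sum q \<kappa>1 \<kappa>2 (m - int a) r (Suc s))"
proof -
  have "q ^ (\<Sum>j=1..Suc s. (\<Sum>l=1..j. y l) * (x(Suc s := a)) j) =
        q ^ (nat r * a) * q ^ (\<Sum>j=1..s. (\<Sum>l=1..j. y l) * x j)"
    if "y \<in> tuples (Suc s) \<kappa>2 r" for x y a
  proof -
    have "(\<Sum>j=1..s. (\<Sum>l=1..j. y l) * (x(Suc s := a)) j) = (\<Sum>j=1..s. (\<Sum>l=1..j. y l) * x j)"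
      by (rule sum.cong) auto
    then show ?thesis using sum_entries_tuple[OF that] by (simp add: power_add mult.commute)
  qed
  then show ?thesis
    unfolding D_sum_def A_sum_def sum_tuples_Suc[of _ s \<kappa>1] by (simp add: sum_distrib_left)
qed

lemma A_sum_last_failure_run:
  "A_sum q \<kappa>1 \<kappa>2 m r (Suc (Suc s)) = (\<Sum>b\<in>{0<..<\<kappa>2}. D_sum q \<kappa>1 \<kappa>2 m (r - int b) (Suc s))"
proof -
  have "(\<Sum>j=1..Suc s. (\<Sum>l=1..j. (y(Suc (Suc s) := b)) l) * x j) =
        (\<Sum>j=1..Suc s. (\<Sum>l=1..j. y l) * x j)" for x y :: "nat \<Rightarrow> nat" and b
    by (intro sum.cong arg_cong2[where f = "(*)"] refl) auto
  then show ?thesis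
    unfolding D_sum_def A_sum_def sum_tuples_Suc[of _ "Suc s" \<kappa>2]
    by (subst sum.swap) (simp del: sum.cl_ivl_Suc)
qed

lemma C_sum_last_success_run:
  "C_sum q \<kappa>1 \<kappa>2 m r (Suc (Suc s)) =
   (\<Sum>a\<in>{0<..<\<kappa>1}. q ^ (nat r * a) * B_sum q \<kappa>1 \<kappa>2 (m - int a) r (Suc s))"
proof -
  have "q ^ (\<Sum>j=2..Suc (Suc s). (\<Sum>l=1..j - 1. y l) * (x(Suc (Suc s) := a)) j) =
        q ^ (nat r * a) * q ^ (\<Sum>j=2..Suc s. (\<Sum>l=1..j - 1. y l) * x j)"
    if "y \<in> tuples (Suc s) \<kappa>2 r" for x y a
  proof -
    have "(\<Sum>j=2..Suc s. (\<Sum>l=1..j - 1. y l) * (x(Suc (Suc s) := a)) j)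
        = (\<Sum>j=2..Suc s. (\<Sum>l=1..j - 1. y l) * x j)"
      by (rule sum.cong) auto
    moreover have "(\<Sum>j=2..Suc (Suc s). f j) = (\<Sum>j=2..Suc s. f j) + f (Suc (Suc s))"
      for f :: "nat \<Rightarrow> nat"
      by (rule sum.cl_ivl_Suc[THEN trans]) simp
    ultimately show ?thesis using sum_entries_tuple[OF that]
      by (simp add: power_add mult.commute del: sum.cl_ivl_Suc)
  qed
  then show ?thesis
    unfolding B_sum_def C_sum_def sum_tuples_Suc[of _ "Suc s" \<kappa>1] by (simp add: sum_distrib_left)
qed

lemma B_sum_last_failure_run:
  "B_sum q \<kappa>1 \<kappa>2 m r (Suc s) = (\<Sum>b\<in>{0<..<\<kappa>2}. C_sum q \<kappa>1 \<kappa>2 m (r - int b) (Suc s))"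
proof -
  have "(\<Sum>j=2..Suc s. (\<Sum>l=1..j - 1. (y(Suc s := b)) l) * x j) =
        (\<Sum>j=2..Suc s. (\<Sum>l=1..j - 1. y l) * x j)" for x y :: "nat \<Rightarrow> nat" and b
    by (intro sum.cong arg_cong2[where f = "(*)"] refl) auto
  then show ?thesis
    unfolding B_sum_def C_sum_def sum_tuples_Suc[of _ s \<kappa>2]
    by (subst sum.swap) (simp del: sum.cl_ivl_Suc)
qed

text \<open>
  The recursions stop at words that consist of one run. Those remaining sums are written over the
  length of that run, in the form that the recursions produce for an empty word before it.
\<close>

lemma A_sum_1:
  "A_sum q \<kappa>1 \<kappa>2 m r (Suc 0) = (\<Sum>b\<in>{0<..<\<kappa>2}. of_bool (m = 0 \<and> r - int b = 0))"
  unfolding A_sum_def sum_tuples_Suc[of _ 0 \<kappa>2]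
  by (cases "m = 0") (auto simp: tuples_0 simp del: sum_of_bool_eq intro!: sum.cong)

lemma C_sum_1:
  "C_sum q \<kappa>1 \<kappa>2 m r (Suc 0) =
   (\<Sum>a\<in>{0<..<\<kappa>1}. q ^ (nat r * a) * of_bool (m - int a = 0 \<and> r = 0))"
  unfolding C_sum_def sum_tuples_Suc[of _ 0 \<kappa>1]
  by (cases "r = 0") (auto simp: tuples_0 simp del: sum_of_bool_eq intro!: sum.cong)

text \<open>
  The generating functions, in powers of \<open>q\<close>, of the words with \<open>m\<close> successes and \<open>r\<close> failures whose
  last run is a success run or a failure run, respectively, all runs of successes being shorter than
  \<open>\<kappa>1\<close> and all runs of failures shorter than \<open>\<kappa>2\<close>. The empty word counts for both, so that a word with
  a single run needs no separate treatment in the recursions below. The cutoff \<open>N\<close> can be any bound on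
  \<open>r\<close>; it is a parameter because removing a failure run lowers \<open>r\<close> and must not change the range of \<open>s\<close>.
\<close>

definition success_ending_sum :: "real \<Rightarrow> nat \<Rightarrow> nat \<Rightarrow> nat \<Rightarrow> int \<Rightarrow> int \<Rightarrow> real" where
  "success_ending_sum q \<kappa>1 \<kappa>2 N m r =
     (\<Sum>s=1..N. D_sum q \<kappa>1 \<kappa>2 m r s) + (\<Sum>s=1..Suc N. C_sum q \<kappa>1 \<kappa>2 m r s) + of_bool (m = 0 \<and> r = 0)"

definition failure_ending_sum :: "real \<Rightarrow> nat \<Rightarrow> nat \<Rightarrow> nat \<Rightarrow> int \<Rightarrow> int \<Rightarrow> real" where
  "failure_ending_sum q \<kappa>1 \<kappa>2 N m r =
     (\<Sum>s=1..N. A_sum q \<kappa>1 \<kappa>2 m r s) + (\<Sum>s=1..N. B_sum q \<kappa>1 \<kappa>2 m r s) + of_bool (m = 0 \<and> r = 0)"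

lemma success_ending_sum_rec:
  "success_ending_sum q \<kappa>1 \<kappa>2 N m r = of_bool (m = 0 \<and> r = 0) +
     (\<Sum>a\<in>{0<..<\<kappa>1}. q ^ (nat r * a) * failure_ending_sum q \<kappa>1 \<kappa>2 N (m - int a) r)"
proof -
  have "(\<Sum>s<N. D_sum q \<kappa>1 \<kappa>2 m r (Suc s)) =
      (\<Sum>a\<in>{0<..<\<kappa>1}. q ^ (nat r * a) * (\<Sum>s<N. A_sum q \<kappa>1 \<kappa>2 (m - int a) r (Suc s)))"
    unfolding D_sum_last_success_run sum_distrib_left by (rule sum.swap)
  moreover have "(\<Sum>s<Suc N. C_sum q \<kappa>1 \<kappa>2 m r (Suc s)) =
      C_sum q \<kappa>1 \<kappa>2 m r (Suc 0) +
      (\<Sum>a\<in>{0<..<\<kappa>1}. q ^ (nat r * a) * (\<Sum>s<N. B_sum q \<kappa>1 \<kappa>2 (m - int a) r (Suc s)))"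
    unfolding sum.lessThan_Suc_shift C_sum_last_success_run sum_distrib_left
    by (rule arg_cong2[where f = "(+)", OF refl sum.swap])
  ultimately show ?thesis
    unfolding success_ending_sum_def failure_ending_sum_def C_sum_1 One_nat_def
      sum.atLeast1_atMost_eq distrib_left sum.distrib
    by (simp only: add_ac)
qed

text \<open>
  Removing a failure run lowers the number of failure runs, so the recursion for \<open>s \<le> N\<close> produces
  \<open>D\<close> only for \<open>s < N\<close> and \<open>C\<close> only for \<open>s \<le> N\<close>. The missing last terms vanish, because fewer than \<open>N\<close>
  failures remain.
\<close>

lemma failure_ending_sum_rec:
  assumes "r \<le> int N"
  shows "failure_ending_sum q \<kappa>1 \<kappa>2 N m r = of_bool (m = 0 \<and> r = 0) +
     (\<Sum>b\<in>{0<..<\<kappa>2}. success_ending_sum q \<kappa>1 \<kappa>2 N m (r - int b))"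
proof -
  have D0: "D_sum q \<kappa>1 \<kappa>2 m (r - int b) N = 0" and C0: "C_sum q \<kappa>1 \<kappa>2 m (r - int b) (Suc N) = 0"
    if "b \<in> {0<..<\<kappa>2}" for b
    using that assms by (simp_all add: D_sum_def C_sum_def tuples_eq_empty_if_long)
  have "(\<Sum>s<N. B_sum q \<kappa>1 \<kappa>2 m r (Suc s)) =
      (\<Sum>b\<in>{0<..<\<kappa>2}. \<Sum>s<N. C_sum q \<kappa>1 \<kappa>2 m (r - int b) (Suc s))"
    unfolding B_sum_last_failure_run by (rule sum.swap)
  also have "\<dots> = (\<Sum>b\<in>{0<..<\<kappa>2}. \<Sum>s<Suc N. C_sum q \<kappa>1 \<kappa>2 m (r - int b) (Suc s))"
    using C0 by (intro sum.cong[OF refl]) simp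
  finally have B: "(\<Sum>s<N. B_sum q \<kappa>1 \<kappa>2 m r (Suc s)) = \<dots>" .
  have A: "(\<Sum>s<N. A_sum q \<kappa>1 \<kappa>2 m r (Suc s)) =
      (\<Sum>b\<in>{0<..<\<kappa>2}. of_bool (m = 0 \<and> r - int b = 0)) +
      (\<Sum>b\<in>{0<..<\<kappa>2}. \<Sum>s<N. D_sum q \<kappa>1 \<kappa>2 m (r - int b) (Suc s))"
  proof (cases N)
    case 0
    then show ?thesis using assms by (auto simp del: sum_of_bool_eq intro!: sum.neutral)
  next
    case (Suc N')
    have "(\<Sum>s<N. A_sum q \<kappa>1 \<kappa>2 m r (Suc s)) =
        A_sum q \<kappa>1 \<kappa>2 m r (Suc 0) +
        (\<Sum>b\<in>{0<..<\<kappa>2}. \<Sum>s<N'. D_sum q \<kappa>1 \<kappa>2 m (r - int b) (Suc s))"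
      unfolding Suc sum.lessThan_Suc_shift A_sum_last_failure_run
      by (rule arg_cong2[where f = "(+)", OF refl sum.swap])
    also have "(\<Sum>b\<in>{0<..<\<kappa>2}. \<Sum>s<N'. D_sum q \<kappa>1 \<kappa>2 m (r - int b) (Suc s)) =
        (\<Sum>b\<in>{0<..<\<kappa>2}. \<Sum>s<N. D_sum q \<kappa>1 \<kappa>2 m (r - int b) (Suc s))"
      using D0 by (intro sum.cong[OF refl]) (simp add: Suc)
    finally show ?thesis by (simp only: A_sum_1)
  qed
  show ?thesis
    unfolding success_ending_sum_def failure_ending_sum_def One_nat_def
      sum.atLeast1_atMost_eq sum.distrib A B
    by (simp only: add_ac)
qed

lemma ending_sums_negative:
  assumes "m < 0 \<or> r < 0"
  shows "success_ending_sum q \<kappa>1 \<kappa>2 N m r = 0" "failure_ending_sum q \<kappa>1 \<kappa>2 N m r = 0"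
proof -
  have "A_sum q \<kappa>1 \<kappa>2 m r s = 0 \<and> B_sum q \<kappa>1 \<kappa>2 m r s = 0 \<and>
      C_sum q \<kappa>1 \<kappa>2 m r s = 0 \<and> D_sum q \<kappa>1 \<kappa>2 m r s = 0" for s
  proof (cases "m < 0")
    case True
    then show ?thesis
      by (simp add: A_sum_def B_sum_def C_sum_def D_sum_def tuples_eq_empty_if_neg)
  next
    case False
    then have "r < 0" using assms by simp
    then show ?thesis
      by (simp add: A_sum_def B_sum_def C_sum_def D_sum_def tuples_eq_empty_if_neg)
  qed
  moreover have "\<not> (m = 0 \<and> r = 0)" using assms by auto
  ultimately show "success_ending_sum q \<kappa>1 \<kappa>2 N m r = 0" "failure_ending_sum q \<kappa>1 \<kappa>2 N m r = 0"
    by (simp_all only: success_ending_sum_def failure_ending_sum_def sum.neutral_const of_bool_eq simp_thms add_0)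
qed

section \<open>Removing the last run of a word\<close>

definition zeros :: "(nat \<Rightarrow> nat) \<Rightarrow> nat \<Rightarrow> nat" where
  "zeros x n = card {l \<in> {1..n}. x l = 0}"

lemma zeros_0 [simp]: "zeros x 0 = 0"
  by (simp add: zeros_def)

lemma zeros_Suc: "zeros x (Suc n) = zeros x n + of_bool (x (Suc n) = 0)"
proof -
  have "{l \<in> {1..Suc n}. x l = 0} =
      (if x (Suc n) = 0 then insert (Suc n) {l \<in> {1..n}. x l = 0} else {l \<in> {1..n}. x l = 0})"
    by (auto simp: le_Suc_eq)
  then show ?thesis by (simp add: zeros_def)
qed

lemma zeros_le: "zeros x n \<le> n"
  by (induction n) (auto simp: zeros_Suc)

lemma zeros_cong: "(\<And>j. j \<in> {1..n} \<Longrightarrow> x j = y j) \<Longrightarrow> zeros x n = zeros y n"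
  unfolding zeros_def by (rule arg_cong[where f = card]) auto

lemma zeros_append_run:
  "\<forall>j\<in>{n + 1..n + l}. x j = v \<Longrightarrow> zeros x (n + l) = zeros x n + (if v = 0 then l else 0)"
  by (induction l) (auto simp: zeros_Suc)

lemma longest_run_le_iff:
  "longest_run v x n \<le> k \<longleftrightarrow> (\<forall>a l. a + l \<le> n \<longrightarrow> (\<forall>j\<in>{a + 1..a + l}. x j = v) \<longrightarrow> l \<le> k)"
proof -
  let ?S = "{l. \<exists>a. a + l \<le> n \<and> (\<forall>j\<in>{a + 1..a + l}. x j = v)}"
  have "finite ?S" by (rule finite_subset[of _ "{..n}"]) auto
  moreover have "0 \<in> ?S" by auto
  ultimately show ?thesis unfolding longest_run_def by (subst Max_le_iff) blast+
qed

lemma longest_run_cong: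
  assumes "\<And>j. j \<in> {1..n} \<Longrightarrow> x j = y j"
  shows "longest_run v x n = longest_run v y n"
proof -
  have "(\<forall>j\<in>{a + 1..a + l}. x j = v) \<longleftrightarrow> (\<forall>j\<in>{a + 1..a + l}. y j = v)" if "a + l \<le> n" for a l
    using that assms by (intro ball_cong) auto
  then have "{l. \<exists>a. a + l \<le> n \<and> (\<forall>j\<in>{a + 1..a + l}. x j = v)} =
             {l. \<exists>a. a + l \<le> n \<and> (\<forall>j\<in>{a + 1..a + l}. y j = v)}"
    by blast
  then show ?thesis by (simp add: longest_run_def)
qed

text \<open>
  The position \<open>n\<close>, if there is one, does not carry \<open>v\<close>. So a run of \<open>v\<close> cannot cross it and lies
  entirely on one side.
\<close>

lemma longest_run_append_run_same:
  assumes run: "\<forall>j\<in>{n + 1..n + l}. x j = v" and sep: "n = 0 \<or> x n \<noteq> v"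
  shows "longest_run v x (n + l) \<le> k \<longleftrightarrow> longest_run v x n \<le> k \<and> l \<le> k"
proof
  assume "longest_run v x (n + l) \<le> k"
  then show "longest_run v x n \<le> k \<and> l \<le> k"
    using run unfolding longest_run_le_iff by (meson le_add1 order_refl order_trans)
next
  assume R: "longest_run v x n \<le> k \<and> l \<le> k"
  show "longest_run v x (n + l) \<le> k"
    unfolding longest_run_le_iff
  proof (intro allI impI)
    fix a b assume ab: "a + b \<le> n + l" "\<forall>j\<in>{a + 1..a + b}. x j = v"
    show "b \<le> k"
    proof (cases "a + b \<le> n")
      case True
      then show ?thesis using R ab(2) unfolding longest_run_le_iff by blast
    next
      case False
      \<comment> \<open>a run that reaches beyond \<open>n\<close> must start after \<open>n\<close>\<close>
      have "n \<le> a" using sep ab(2) False by (cases "n \<le> a") force+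
      then show ?thesis using ab(1) R by linarith
    qed
  qed
qed

lemma longest_run_append_run_other:
  assumes run: "\<forall>j\<in>{n + 1..n + l}. x j \<noteq> v"
  shows "longest_run v x (n + l) \<le> k \<longleftrightarrow> longest_run v x n \<le> k"
proof
  assume "longest_run v x (n + l) \<le> k"
  then show "longest_run v x n \<le> k"
    unfolding longest_run_le_iff by (meson le_add1 order_trans)
next
  assume R: "longest_run v x n \<le> k"
  show "longest_run v x (n + l) \<le> k"
    unfolding longest_run_le_iff
  proof (intro allI impI)
    fix a b assume ab: "a + b \<le> n + l" "\<forall>j\<in>{a + 1..a + b}. x j = v"
    have "a + b \<le> n \<or> b = 0"
    proof (rule ccontr)
      assume "\<not> (a + b \<le> n \<or> b = 0)"
      then have "a + b \<in> {n + 1..n + l}" "a + b \<in> {a + 1..a + b}" using ab(1) by auto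
      then show False using run ab(2) by blast
    qed
    then show "b \<le> k" using R ab(2) unfolding longest_run_le_iff by auto
  qed
qed

text \<open>
  The words of length \<open>n\<close> whose probabilities are computed: \<open>k u\<close> bounds the runs of \<open>u\<close>, and both the
  number of failures and the last letter are fixed, since these are what the removal of the last run
  needs. The empty word is admitted for either value of \<open>v\<close>.
\<close>

definition bounded_runs :: "(nat \<Rightarrow> nat) \<Rightarrow> nat \<Rightarrow> nat \<Rightarrow> nat \<Rightarrow> (nat \<Rightarrow> nat) \<Rightarrow> bool" where
  "bounded_runs k v n i x \<longleftrightarrow>
     (\<forall>u\<in>{0, 1}. longest_run u x n \<le> k u) \<and> zeros x n = i \<and> (n = 0 \<or> x n = v)"

definition run_after :: "nat \<Rightarrow> nat \<Rightarrow> nat \<Rightarrow> (nat \<Rightarrow> nat) \<Rightarrow> bool" where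
  "run_after v n l x \<longleftrightarrow> (\<forall>j\<in>{n + 1..n + l}. x j = v)"

lemma bounded_runs_cong:
  assumes "\<And>j. j \<in> {1..n} \<Longrightarrow> x j = y j"
  shows "bounded_runs k v n i x \<longleftrightarrow> bounded_runs k v n i y"
  using assms longest_run_cong[of n x y] zeros_cong[of n x y]
  by (cases n) (auto simp: bounded_runs_def)

text \<open>
  The last run has some length \<open>l\<close>, and what precedes it is a word of the same kind that is empty or ends
  with the other letter \<open>1 - v\<close>. The factor \<open>1 - v\<close> in front of \<open>l\<close> states that the run contributes \<open>l\<close> zeros
  if it is a failure run and none if it is a success run. The inequality \<open>(1 - v) * l \<le> i\<close> guards
  against truncated subtraction.
\<close>

lemma bounded_runs_last_run:
  assumes v: "v \<in> {0, 1}" and n: "n \<ge> 1" and x: "\<And>j. j \<in> {1..n} \<Longrightarrow> x j \<in> {0, 1}"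
  shows "bounded_runs k v n i x \<longleftrightarrow>
    (\<exists>l\<in>{1..k v}. l \<le> n \<and> (1 - v) * l \<le> i \<and>
       bounded_runs k (1 - v) (n - l) (i - (1 - v) * l) x \<and> run_after v (n - l) l x)"
proof -
  have step: "bounded_runs k v n i x \<longleftrightarrow> l \<le> k v \<and> (1 - v) * l \<le> i \<and>
       bounded_runs k (1 - v) (n - l) (i - (1 - v) * l) x"
    if l: "1 \<le> l" "l \<le> n" and run: "run_after v (n - l) l x" and sep: "n - l = 0 \<or> x (n - l) = 1 - v" for l
  proof -
    obtain m where m: "n = m + l" using l(2) by (metis le_add_diff_inverse2)
    have run': "\<forall>j\<in>{m + 1..m + l}. x j = v" using run by (simp add: run_after_def m)
    then have "x n = v" using l m by auto
    moreover have "longest_run v x n \<le> k v \<longleftrightarrow> longest_run v x m \<le> k v \<and> l \<le> k v"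
      unfolding m using sep v m by (intro longest_run_append_run_same run') auto
    moreover have "longest_run (1 - v) x n \<le> k (1 - v) \<longleftrightarrow> longest_run (1 - v) x m \<le> k (1 - v)"
      unfolding m using run' v by (intro longest_run_append_run_other) auto
    moreover have "zeros x n = zeros x m + (1 - v) * l"
      using zeros_append_run[OF run'] v m by auto
    ultimately show ?thesis using v sep by (auto simp: bounded_runs_def m)
  qed
  show ?thesis
  proof
    assume G: "bounded_runs k v n i x"
    then have xn: "x n = v" using n by (simp add: bounded_runs_def)
    \<comment> \<open>the last run is the longest block of \<open>v\<close>s that ends at \<open>n\<close>\<close>
    define P where "P l \<longleftrightarrow> l \<le> n \<and> run_after v (n - l) l x" for l
    have P1: "P 1" using n xn by (simp add: P_def run_after_def)
    define l where "l = (GREATEST l. P l)"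
    have Pl: "P l" and max: "P l' \<Longrightarrow> l' \<le> l" for l'
      unfolding l_def using GreatestI_nat[of P 1 n] Greatest_le_nat[of P l' n] P1
      by (auto simp: P_def)
    have l: "1 \<le> l" "l \<le> n" using max[OF P1] Pl by (auto simp: P_def)
    have "x (n - l) \<noteq> v" if "n - l \<noteq> 0"
    proof
      assume xv: "x (n - l) = v"
      have "x j = v" if j: "j \<in> {n - Suc l + 1..n - Suc l + Suc l}" for j
      proof (cases "j = n - l")
        case True
        then show ?thesis using xv by simp
      next
        case False
        then have "j \<in> {n - l + 1..n - l + l}" using j \<open>n - l \<noteq> 0\<close> by auto
        then show ?thesis using Pl unfolding P_def run_after_def by blast
      qed
      then have "P (Suc l)" using that by (simp add: P_def run_after_def)
      then show False using max by fastforce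
    qed
    then have "n - l = 0 \<or> x (n - l) = 1 - v"
      using x[of "n - l"] v by (cases "n - l = 0") (auto simp: Suc_le_eq)
    then show "\<exists>l\<in>{1..k v}. l \<le> n \<and> (1 - v) * l \<le> i \<and>
       bounded_runs k (1 - v) (n - l) (i - (1 - v) * l) x \<and> run_after v (n - l) l x"
      using step[OF l] Pl G l by (auto simp: P_def)
  next
    assume "\<exists>l\<in>{1..k v}. l \<le> n \<and> (1 - v) * l \<le> i \<and>
       bounded_runs k (1 - v) (n - l) (i - (1 - v) * l) x \<and> run_after v (n - l) l x"
    then obtain l where l: "l \<in> {1..k v}" "l \<le> n" "(1 - v) * l \<le> i"
      "bounded_runs k (1 - v) (n - l) (i - (1 - v) * l) x" "run_after v (n - l) l x" by blast
    then show "bounded_runs k v n i x"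
      using step[of l] by (auto simp: bounded_runs_def)
  qed
qed

lemma last_run_length_unique:
  assumes "v \<in> {0, 1}" "l \<le> n" "l' \<le> n"
    and "bounded_runs k (1 - v) (n - l) i x" "run_after v (n - l) l x"
    and "bounded_runs k (1 - v) (n - l') i' x" "run_after v (n - l') l' x"
  shows "l = l'"
proof -
  have False
    if "a < b" "b \<le> n" "bounded_runs k (1 - v) (n - a) j x" "run_after v (n - b) b x" for a b j
  proof -
    have "x (n - a) = 1 - v" using that(1-3) by (auto simp: bounded_runs_def)
    moreover have "x (n - a) = v" using that by (auto simp: run_after_def)
    ultimately show False using assms(1) by auto
  qed
  then show ?thesis using assms by (metis nat_neq_iff)
qed

section \<open>Removing the last run in the probabilities\<close>

locale q_bernoulli = prob_space M for M :: "'a measure" +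
  fixes X :: "nat \<Rightarrow> 'a \<Rightarrow> nat" and q \<theta> :: real
  assumes process: "q_bernoulli_process q \<theta> M X"
begin

lemma measurable_X: "j \<ge> 1 \<Longrightarrow> X j \<in> measurable M (count_space {0, 1})"
  using process by (auto simp: q_bernoulli_process_def)

lemma X_values: "j \<ge> 1 \<Longrightarrow> \<omega> \<in> space M \<Longrightarrow> X j \<omega> \<in> {0, 1}"
  using measurable_space[OF measurable_X[of j]] by auto

definition history :: "nat \<Rightarrow> (nat \<Rightarrow> nat) \<Rightarrow> 'a set" where
  "history n w = {\<omega> \<in> space M. \<forall>l\<in>{1..n}. X l \<omega> = w l}"

lemma sets_history: "history n w \<in> sets M"
proof -
  have "{\<omega> \<in> space M. X l \<omega> = w l} \<in> sets M" if "l \<in> {1..n}" for l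
  proof -
    have "X l -` ({w l} \<inter> {0, 1}) \<inter> space M \<in> sets M"
      using that by (intro measurable_sets[OF measurable_X]) auto
    also have "X l -` ({w l} \<inter> {0, 1}) \<inter> space M = {\<omega> \<in> space M. X l \<omega> = w l}"
      using X_values[of l] that by auto
    finally show ?thesis .
  qed
  then show ?thesis
    unfolding history_def by (intro sets.sets_Collect_finite_All) auto
qed

definition event :: "((nat \<Rightarrow> nat) \<Rightarrow> bool) \<Rightarrow> 'a set" where
  "event \<Phi> = {\<omega> \<in> space M. \<Phi> (\<lambda>j. X j \<omega>)}"

text \<open>
  The events below are unions of histories of length \<open>n\<close>: those given by predicates that look only at
  the letters \<open>1, \<dots>, n\<close>. In particular, \<open>X 0\<close> is ignored.
\<close>

definition determined_by :: "nat \<Rightarrow> ((nat \<Rightarrow> nat) \<Rightarrow> bool) \<Rightarrow> bool" where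
  "determined_by n \<Phi> \<longleftrightarrow> (\<forall>x y. (\<forall>j\<in>{1..n}. x j = y j) \<longrightarrow> \<Phi> x = \<Phi> y)"

lemma event_eq_Union_histories:
  assumes "determined_by n \<Phi>"
  shows "event \<Phi> = (\<Union>w\<in>{w \<in> {1..n} \<rightarrow>\<^sub>E {0, 1}. \<Phi> w}. history n w)"
proof (intro equalityI subsetI)
  fix \<omega> assume \<omega>: "\<omega> \<in> event \<Phi>"
  let ?w = "restrict (\<lambda>j. X j \<omega>) {1..n}"
  have "\<Phi> ?w = \<Phi> (\<lambda>j. X j \<omega>)"
    using assms[unfolded determined_by_def, rule_format, of ?w "\<lambda>j. X j \<omega>"] by simp
  moreover have "?w \<in> {1..n} \<rightarrow>\<^sub>E {0, 1}" using \<omega> X_values by (auto simp: event_def)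
  moreover have "\<omega> \<in> history n ?w" using \<omega> by (auto simp: history_def event_def)
  ultimately show "\<omega> \<in> (\<Union>w\<in>{w \<in> {1..n} \<rightarrow>\<^sub>E {0, 1}. \<Phi> w}. history n w)"
    using \<omega> by (intro UN_I[of ?w]) (auto simp: event_def)
next
  fix \<omega> assume "\<omega> \<in> (\<Union>w\<in>{w \<in> {1..n} \<rightarrow>\<^sub>E {0, 1}. \<Phi> w}. history n w)"
  then obtain w where w: "\<Phi> w" "\<omega> \<in> history n w" by auto
  then have "\<Phi> w = \<Phi> (\<lambda>j. X j \<omega>)"
    using assms[unfolded determined_by_def, rule_format, of w "\<lambda>j. X j \<omega>"]
    by (auto simp: history_def)
  then show "\<omega> \<in> event \<Phi>" using w by (auto simp: event_def history_def)
qed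

lemma finite_words: "finite {w \<in> {1..n::nat} \<rightarrow>\<^sub>E {0, 1::nat}. \<Phi> w}"
  by (rule finite_subset[of _ "{1..n} \<rightarrow>\<^sub>E {0, 1}"]) (auto simp del: One_nat_def intro!: finite_PiE)

lemma sets_event: "determined_by n \<Phi> \<Longrightarrow> event \<Phi> \<in> sets M"
  unfolding event_eq_Union_histories by (intro sets.finite_UN finite_words sets_history)

lemma disjoint_histories: "disjoint_family_on (history n) {w \<in> {1..n} \<rightarrow>\<^sub>E {0, 1}. \<Phi> w}"
proof (unfold disjoint_family_on_def, intro ballI impI)
  fix w w' assume *: "w \<in> {w \<in> {1..n} \<rightarrow>\<^sub>E {0, 1}. \<Phi> w}" "w' \<in> {w \<in> {1..n} \<rightarrow>\<^sub>E {0, 1}. \<Phi> w}" "w \<noteq> w'"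
  then obtain l where "l \<in> {1..n}" "w l \<noteq> w' l" by (metis (no_types, lifting) PiE_ext mem_Collect_eq)
  then show "history n w \<inter> history n w' = {}" by (auto simp: history_def)
qed

lemma prob_event:
  assumes "determined_by n \<Phi>"
  shows "prob (event \<Phi>) = (\<Sum>w\<in>{w \<in> {1..n} \<rightarrow>\<^sub>E {0, 1}. \<Phi> w}. prob (history n w))"
  unfolding event_eq_Union_histories[OF assms]
  by (rule finite_measure_finite_Union[OF finite_words _ disjoint_histories])
    (auto simp: sets_history)

definition next_prob :: "nat \<Rightarrow> nat \<Rightarrow> real" where
  "next_prob v i = (if v = 0 then 1 - \<theta> * q ^ i else \<theta> * q ^ i)"

text \<open>
  The defining property of the process constrains only histories of positive probability. For the
  others, both sides are zero by monotonicity.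
\<close>

lemma prob_history_extend:
  assumes v: "v \<in> {0, 1}"
  shows "prob (history n w \<inter> {\<omega> \<in> space M. X (Suc n) \<omega> = v}) =
    prob (history n w) * next_prob v (zeros w n)"
proof (cases "prob (history n w) = 0")
  case True
  have "prob (history n w \<inter> {\<omega> \<in> space M. X (Suc n) \<omega> = v}) \<le> prob (history n w)"
    by (rule finite_measure_mono) (auto simp: sets_history)
  then show ?thesis using True measure_nonneg[of M] by (simp add: order_antisym)
next
  case False
  have iv: "{1..<Suc n} = {1..n}" by auto
  have pos: "prob (history n w) > 0" using False by (simp add: less_le)
  then have "\<P>(\<omega> in M. X (Suc n) \<omega> = v \<bar> \<forall>l\<in>{1..<Suc n}. X l \<omega> = w l) = next_prob v (zeros w n)"
    using process[unfolded q_bernoulli_process_def, THEN conjunct2, THEN conjunct2, rule_format,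
        of "Suc n" w, unfolded iv] v
    unfolding iv by (auto simp: history_def next_prob_def zeros_def simp del: atLeastAtMost_iff)
  moreover have "{\<omega> \<in> space M. X (Suc n) \<omega> = v \<and> (\<forall>l\<in>{1..n}. X l \<omega> = w l)} =
      history n w \<inter> {\<omega> \<in> space M. X (Suc n) \<omega> = v}"
    by (auto simp: history_def)
  ultimately show ?thesis
    using pos unfolding cond_prob_def iv by (simp add: history_def field_simps)
qed

text \<open>
  The conditional law of the next letter depends on the history only through its number of zeros.
  It is therefore the same for all histories that make up an event on which that number is constant.
\<close>

lemma prob_event_extend:
  assumes det: "determined_by n \<Phi>" and i: "\<And>x. \<Phi> x \<Longrightarrow> zeros x n = i" and v: "v \<in> {0, 1}"
  shows "prob (event (\<lambda>x. \<Phi> x \<and> x (Suc n) = v)) = prob (event \<Phi>) * next_prob v i"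
proof -
  let ?W = "{w \<in> {1..n} \<rightarrow>\<^sub>E {0, 1}. \<Phi> w}" and ?V = "{\<omega> \<in> space M. X (Suc n) \<omega> = v}"
  have V: "history n w \<inter> ?V \<in> sets M" for w
  proof -
    have "history n w \<inter> ?V = history (Suc n) (w(Suc n := v))"
      by (auto simp: history_def atLeastAtMostSuc_conv)
    then show ?thesis by (simp add: sets_history)
  qed
  have "event (\<lambda>x. \<Phi> x \<and> x (Suc n) = v) = event \<Phi> \<inter> ?V" by (auto simp: event_def)
  also have "\<dots> = (\<Union>w\<in>?W. history n w \<inter> ?V)"
    unfolding event_eq_Union_histories[OF det] by blast
  finally have "prob (event (\<lambda>x. \<Phi> x \<and> x (Suc n) = v)) = prob (\<Union>w\<in>?W. history n w \<inter> ?V)"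
    by (rule arg_cong)
  also have "\<dots> = (\<Sum>w\<in>?W. prob (history n w \<inter> ?V))"
    using disjoint_histories[of n \<Phi>] V
    by (intro finite_measure_finite_Union finite_words) (auto simp: disjoint_family_on_def)
  also have "\<dots> = (\<Sum>w\<in>?W. prob (history n w) * next_prob v i)"
    by (rule sum.cong[OF refl]) (simp only: prob_history_extend[OF v] i mem_Collect_eq)
  finally show ?thesis by (simp add: prob_event[OF det] sum_distrib_right)
qed

lemma determined_by_run_after:
  assumes "determined_by n \<Phi>"
  shows "determined_by (n + l) (\<lambda>x. \<Phi> x \<and> run_after v n l x)"
  unfolding determined_by_def
proof (intro allI impI)
  fix x y :: "nat \<Rightarrow> nat" assume eq: "\<forall>j\<in>{1..n + l}. x j = y j"
  then have "\<Phi> x = \<Phi> y" using assms by (auto simp: determined_by_def)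
  moreover have "run_after v n l x = run_after v n l y"
    unfolding run_after_def using eq by (intro ball_cong) auto
  ultimately show "(\<Phi> x \<and> run_after v n l x) = (\<Phi> y \<and> run_after v n l y)" by simp
qed

text \<open>
  Along a failure run the number of zeros grows with each letter; along a success run it stays at \<open>i\<close>.
\<close>

lemma prob_event_append_run:
  assumes det: "determined_by n \<Phi>" and i: "\<And>x. \<Phi> x \<Longrightarrow> zeros x n = i" and v: "v \<in> {0, 1}"
  shows "prob (event (\<lambda>x. \<Phi> x \<and> run_after v n l x)) =
         prob (event \<Phi>) * (\<Prod>j<l. next_prob v (i + (1 - v) * j))"
proof (induction l)
  case 0
  then show ?case by (simp add: run_after_def)
next
  case (Suc l)
  have "event (\<lambda>x. \<Phi> x \<and> run_after v n (Suc l) x) =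
        event (\<lambda>x. (\<Phi> x \<and> run_after v n l x) \<and> x (Suc (n + l)) = v)"
    by (auto simp: event_def run_after_def le_Suc_eq)
  then have "prob (event (\<lambda>x. \<Phi> x \<and> run_after v n (Suc l) x)) =
        prob (event (\<lambda>x. (\<Phi> x \<and> run_after v n l x) \<and> x (Suc (n + l)) = v))"
    by (rule arg_cong)
  also have "\<dots> = prob (event (\<lambda>x. \<Phi> x \<and> run_after v n l x)) * next_prob v (i + (1 - v) * l)"
    using v i zeros_append_run[of n l _ v]
    by (intro prob_event_extend determined_by_run_after det) (auto simp: run_after_def)
  finally show ?case by (simp add: Suc.IH)
qed

lemma determined_by_bounded_runs: "determined_by n (bounded_runs k v n i)"
  unfolding determined_by_def by (intro allI impI bounded_runs_cong) blast

lemma prob_bounded_runs_rec: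
  assumes v: "v \<in> {0, 1}" and n: "n \<ge> 1"
  shows "prob (event (bounded_runs k v n i)) =
    (\<Sum>l\<in>{l \<in> {1..k v}. l \<le> n \<and> (1 - v) * l \<le> i}.
       prob (event (bounded_runs k (1 - v) (n - l) (i - (1 - v) * l))) *
       (\<Prod>j<l. next_prob v (i - (1 - v) * l + (1 - v) * j)))"
proof -
  let ?L = "{l \<in> {1..k v}. l \<le> n \<and> (1 - v) * l \<le> i}"
  let ?E = "\<lambda>l x. bounded_runs k (1 - v) (n - l) (i - (1 - v) * l) x \<and> run_after v (n - l) l x"
  have eq: "event (bounded_runs k v n i) = (\<Union>l\<in>?L. event (?E l))"
  proof -
    have "bounded_runs k v n i (\<lambda>j. X j \<omega>) \<longleftrightarrow> (\<exists>l\<in>?L. ?E l (\<lambda>j. X j \<omega>))" if "\<omega> \<in> space M" for \<omega>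
    proof -
      have "X j \<omega> \<in> {0, 1}" if "j \<in> {1..n}" for j
        using that X_values[OF _ \<open>\<omega> \<in> space M\<close>, of j] by simp
      from bounded_runs_last_run[OF v n this, where k = k and i = i] show ?thesis
        unfolding Bex_def mem_Collect_eq conj_assoc .
    qed
    then show ?thesis unfolding event_def by blast
  qed
  have "prob (event (bounded_runs k v n i)) = (\<Sum>l\<in>?L. prob (event (?E l)))"
    unfolding eq
  proof (rule finite_measure_finite_Union)
    show "(\<lambda>l. event (?E l)) ` ?L \<subseteq> sets M"
      using sets_event[OF determined_by_run_after[OF determined_by_bounded_runs]] by blast
    show "disjoint_family_on (\<lambda>l. event (?E l)) ?L"
      unfolding disjoint_family_on_def
    proof (intro ballI impI)
      fix l l' assume "l \<in> ?L" "l' \<in> ?L" "l \<noteq> l'"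
      then have "\<not> (?E l x \<and> ?E l' x)" for x
        using last_run_length_unique[OF v, of l n l' k _ x] by blast
      then show "event (?E l) \<inter> event (?E l') = {}" unfolding event_def by blast
    qed
  qed auto
  also have "\<dots> = (\<Sum>l\<in>?L. prob (event (bounded_runs k (1 - v) (n - l) (i - (1 - v) * l))) *
       (\<Prod>j<l. next_prob v (i - (1 - v) * l + (1 - v) * j)))"
    by (rule sum.cong[OF refl], rule prob_event_append_run[OF determined_by_bounded_runs _ v])
      (simp add: bounded_runs_def)
  finally show ?thesis .
qed

lemma prob_bounded_runs_0: "prob (event (bounded_runs k v 0 i)) = of_bool (i = 0)"
proof -
  have "event (bounded_runs k v 0 i) = (if i = 0 then space M else {})"
    by (auto simp: event_def bounded_runs_def longest_run_le_iff)
  then show ?thesis by (simp add: prob_space)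
qed

end

section \<open>Comparison of the two recursions\<close>

lemma prod_lessThan_add:
  fixes f :: "nat \<Rightarrow> 'b::comm_monoid_mult"
  shows "prod f {..<a + b} = prod f {..<a} * (\<Prod>j<b. f (a + j))"
  by (induction b) (simp_all add: mult.assoc)

context q_bernoulli
begin

text \<open>
  The part of the probability of a word that depends only on its length \<open>n\<close> and its number \<open>i\<close> of zeros.
  The rest is \<open>q\<close> to the power of the number of pairs formed by a success and an earlier failure.
\<close>

definition base_weight :: "nat \<Rightarrow> nat \<Rightarrow> real" where
  "base_weight n i = \<theta> ^ (n - i) * (\<Prod>j<i. 1 - \<theta> * q ^ j)"

lemma base_weight_append_success_run:
  assumes "i + l \<le> n"
  shows "base_weight (n - l) i * \<theta> ^ l = base_weight n i"
proof -
  have "n - i = (n - l - i) + l" using assms by simp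
  then have "\<theta> ^ (n - i) = \<theta> ^ (n - l - i) * \<theta> ^ l" by (simp only: power_add)
  then show ?thesis by (simp add: base_weight_def)
qed

lemma base_weight_append_failure_run:
  assumes "l \<le> i" "l \<le> n"
  shows "base_weight (n - l) (i - l) * (\<Prod>j<l. 1 - \<theta> * q ^ (i - l + j)) = base_weight n i"
proof -
  have "n - l - (i - l) = n - i" using assms by simp
  then show ?thesis
    using assms prod_lessThan_add[of "\<lambda>j. 1 - \<theta> * q ^ j" "i - l" l]
    by (simp add: base_weight_def)
qed

text \<open>
  Both sides satisfy the same recursion in the last run, so they agree by induction on the length.
  The probabilities sum over run lengths that fit into the word, the generating functions over all
  run lengths up to the bound; the surplus terms have a negative number of successes or failures.
\<close>

lemma prob_bounded_runs:
  assumes "i \<le> N"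
  shows "prob (event (bounded_runs k 1 n i)) =
      base_weight n i * success_ending_sum q (Suc (k 1)) (Suc (k 0)) N (int n - int i) (int i) \<and>
    prob (event (bounded_runs k 0 n i)) =
      base_weight n i * failure_ending_sum q (Suc (k 1)) (Suc (k 0)) N (int n - int i) (int i)"
  using assms
proof (induction n arbitrary: i rule: less_induct)
  case (less n)
  let ?S = "success_ending_sum q (Suc (k 1)) (Suc (k 0)) N"
  let ?F = "failure_ending_sum q (Suc (k 1)) (Suc (k 0)) N"
  have neg: "?S m r = 0" "?F m r = 0" if "m < 0 \<or> r < 0" for m r
    using ending_sums_negative[OF that] by auto
  have range: "{0<..<Suc a} = {1..a}" for a by auto
  have S: "?S m (int i) = of_bool (m = 0 \<and> i = 0) +
      (\<Sum>a\<in>{1..k 1}. q ^ (i * a) * ?F (m - int a) (int i))" for m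
    using success_ending_sum_rec[of q "Suc (k 1)" "Suc (k 0)" N m "int i"] by (simp add: range)
  have F: "?F m (int i) = of_bool (m = 0 \<and> i = 0) + (\<Sum>b\<in>{1..k 0}. ?S m (int i - int b))" for m
    using failure_ending_sum_rec[of "int i" N q "Suc (k 1)" "Suc (k 0)" m] less.prems
    by (simp add: range)
  show ?case
  proof (cases "n = 0")
    case True
    have "?F (- int i - int a) (int i) = 0" if "a \<in> {1..k 1}" for a
      using that by (intro neg) auto
    then have S0: "?S (- int i) (int i) = of_bool (i = 0)"
      unfolding S by simp
    have "?S (- int i) (int i - int b) = 0" if "b \<in> {1..k 0}" for b
      using that by (intro neg) auto
    then have "?F (- int i) (int i) = of_bool (i = 0)"
      unfolding F by simp
    with S0 show ?thesis
      using True by (cases "i = 0") (simp_all add: prob_bounded_runs_0 base_weight_def)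
  next
    case False
    have "prob (event (bounded_runs k 1 n i)) =
       (\<Sum>l\<in>{l \<in> {1..k 1}. l \<le> n}. prob (event (bounded_runs k 0 (n - l) i)) * (\<theta> * q ^ i) ^ l)"
      using prob_bounded_runs_rec[of 1 n k i] False by (simp add: next_prob_def)
    also have "\<dots> = (\<Sum>l\<in>{1..k 1}. base_weight n i * (q ^ (i * l) * ?F (int n - int i - int l) (int i)))"
    proof (rule sum.mono_neutral_cong_left)
      show "\<forall>l\<in>{1..k 1} - {l \<in> {1..k 1}. l \<le> n}.
          base_weight n i * (q ^ (i * l) * ?F (int n - int i - int l) (int i)) = 0"
      proof
        fix l assume "l \<in> {1..k 1} - {l \<in> {1..k 1}. l \<le> n}"
        then have "?F (int n - int i - int l) (int i) = 0" by (intro neg) auto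
        then show "base_weight n i * (q ^ (i * l) * ?F (int n - int i - int l) (int i)) = 0" by simp
      qed
    next
      fix l assume l: "l \<in> {l \<in> {1..k 1}. l \<le> n}"
      then have "prob (event (bounded_runs k 0 (n - l) i)) =
          base_weight (n - l) i * ?F (int n - int i - int l) (int i)"
        using less.IH[of "n - l" i] less.prems by (simp add: of_nat_diff algebra_simps)
      moreover have "base_weight (n - l) i * \<theta> ^ l * ?F (int n - int i - int l) (int i) =
          base_weight n i * ?F (int n - int i - int l) (int i)"
      proof (cases "i + l \<le> n")
        case True
        then show ?thesis by (simp add: base_weight_append_success_run)
      next
        case False
        then have "?F (int n - int i - int l) (int i) = 0" by (intro neg) auto
        then show ?thesis by simp
      qed
      ultimately show "prob (event (bounded_runs k 0 (n - l) i)) * (\<theta> * q ^ i) ^ l =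
          base_weight n i * (q ^ (i * l) * ?F (int n - int i - int l) (int i))"
        by (simp add: power_mult_distrib power_mult mult_ac)
    qed auto
    also have "\<dots> = base_weight n i * ?S (int n - int i) (int i)"
      unfolding S using False by (auto simp: sum_distrib_left)
    finally have success: "prob (event (bounded_runs k 1 n i)) = \<dots>" .
    have "prob (event (bounded_runs k 0 n i)) =
       (\<Sum>l\<in>{l \<in> {1..k 0}. l \<le> n \<and> l \<le> i}.
          prob (event (bounded_runs k 1 (n - l) (i - l))) * (\<Prod>j<l. 1 - \<theta> * q ^ (i - l + j)))"
      using prob_bounded_runs_rec[of 0 n k i] False by (simp add: next_prob_def)
    also have "\<dots> = (\<Sum>l\<in>{1..k 0}. base_weight n i * ?S (int n - int i) (int i - int l))"
    proof (rule sum.mono_neutral_cong_left)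
      show "\<forall>l\<in>{1..k 0} - {l \<in> {1..k 0}. l \<le> n \<and> l \<le> i}.
          base_weight n i * ?S (int n - int i) (int i - int l) = 0"
      proof
        fix l assume "l \<in> {1..k 0} - {l \<in> {1..k 0}. l \<le> n \<and> l \<le> i}"
        then have "?S (int n - int i) (int i - int l) = 0" by (intro neg) auto
        then show "base_weight n i * ?S (int n - int i) (int i - int l) = 0" by simp
      qed
    next
      fix l assume l: "l \<in> {l \<in> {1..k 0}. l \<le> n \<and> l \<le> i}"
      then have "prob (event (bounded_runs k 1 (n - l) (i - l))) =
          base_weight (n - l) (i - l) * ?S (int n - int i) (int i - int l)"
        using less.IH[of "n - l" "i - l"] less.prems by (simp add: of_nat_diff)
      then show "prob (event (bounded_runs k 1 (n - l) (i - l))) * (\<Prod>j<l. 1 - \<theta> * q ^ (i - l + j)) =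
          base_weight n i * ?S (int n - int i) (int i - int l)"
        using base_weight_append_failure_run[of l i n] l by (simp add: mult_ac)
    qed auto
    also have "\<dots> = base_weight n i * ?F (int n - int i) (int i)"
      unfolding F using False by (auto simp: sum_distrib_left)
    finally show ?thesis using success by simp
  qed
qed

text \<open>
  For \<open>n \<ge> 1\<close> the last letter and the number of zeros split the event into disjoint pieces; for \<open>n = 0\<close>
  the empty word would occur twice.
\<close>

lemma event_longest_runs_eq_Union:
  assumes "n \<ge> 1"
  shows "{\<omega> \<in> space M. longest_run 1 (\<lambda>j. X j \<omega>) n \<le> k 1 \<and> longest_run 0 (\<lambda>j. X j \<omega>) n \<le> k 0} =
    (\<Union>(i, v)\<in>{..n} \<times> {0, 1}. event (bounded_runs k v n i))"
proof -
  have "X n \<omega> = 0 \<or> X n \<omega> = 1" if "\<omega> \<in> space M" for \<omega>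
    using X_values[OF assms that] by simp
  then show ?thesis
    using assms zeros_le[of _ n] by (auto simp: event_def bounded_runs_def)
qed

lemma prob_longest_runs:
  assumes "n \<ge> 1"
  shows "\<P>(\<omega> in M. longest_run 1 (\<lambda>j. X j \<omega>) n \<le> k 1 \<and> longest_run 0 (\<lambda>j. X j \<omega>) n \<le> k 0) =
    (\<Sum>i\<le>n. prob (event (bounded_runs k 0 n i)) + prob (event (bounded_runs k 1 n i)))"
proof -
  have "\<P>(\<omega> in M. longest_run 1 (\<lambda>j. X j \<omega>) n \<le> k 1 \<and> longest_run 0 (\<lambda>j. X j \<omega>) n \<le> k 0) =
      (\<Sum>p\<in>{..n} \<times> {0, 1}. prob (case p of (i, v) \<Rightarrow> event (bounded_runs k v n i)))"
    unfolding event_longest_runs_eq_Union[OF assms, of k]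
  proof (rule finite_measure_finite_Union)
    show "disjoint_family_on (\<lambda>p. case p of (i, v) \<Rightarrow> event (bounded_runs k v n i)) ({..n} \<times> {0, 1})"
      using assms by (auto simp: disjoint_family_on_def event_def bounded_runs_def)
  qed (auto intro: sets_event determined_by_bounded_runs)
  also have "\<dots> = (\<Sum>i\<le>n. \<Sum>v\<in>{0, 1}. prob (event (bounded_runs k v n i)))"
    by (subst sum.cartesian_product) (auto intro!: sum.cong)
  finally show ?thesis by simp
qed

end

text \<open>
  Without failures the only word is the all-success word, which accounts for the summand with \<open>eta\<close>.
\<close>

lemma ending_sums_no_failures:
  assumes "n \<ge> 1"
  shows "success_ending_sum q (Suc k1) \<kappa>2 0 (int n) 0 = eta n k1"
    and "failure_ending_sum q \<kappa>1 \<kappa>2 0 (int n) 0 = 0"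
proof -
  have "{0<..<Suc k1} \<inter> {a. int n - int a = 0} = (if n \<le> k1 then {n} else {})"
    using assms by auto
  then have "C_sum q (Suc k1) \<kappa>2 (int n) 0 (Suc 0) = eta n k1"
    by (simp add: C_sum_1 eta_def)
  then show "success_ending_sum q (Suc k1) \<kappa>2 0 (int n) 0 = eta n k1"
    using assms by (simp add: success_ending_sum_def)
  show "failure_ending_sum q \<kappa>1 \<kappa>2 0 (int n) 0 = 0"
    using assms by (simp add: failure_ending_sum_def)
qed

text \<open>
  With at least one failure, \<open>C\<close> with \<open>s = 1\<close> (no failure run) and the empty word contribute nothing,
  which leaves \<open>C\<close> shifted by one: its words have one success run more than failure runs.
\<close>

lemma ending_sums_some_failure:
  assumes "r > 0"
  shows "success_ending_sum q \<kappa>1 \<kappa>2 N m r + failure_ending_sum q \<kappa>1 \<kappa>2 N m r =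
    (\<Sum>s=1..N. D_sum q \<kappa>1 \<kappa>2 m r s + A_sum q \<kappa>1 \<kappa>2 m r s +
              C_sum q \<kappa>1 \<kappa>2 m r (s + 1) + B_sum q \<kappa>1 \<kappa>2 m r s)"
proof -
  have "C_sum q \<kappa>1 \<kappa>2 m r (Suc 0) = 0" using assms by (simp add: C_sum_1)
  then have "(\<Sum>s=1..Suc N. C_sum q \<kappa>1 \<kappa>2 m r s) = (\<Sum>s=1..N. C_sum q \<kappa>1 \<kappa>2 m r (s + 1))"
    unfolding One_nat_def sum.atLeast1_atMost_eq sum.lessThan_Suc_shift by simp
  then show ?thesis
    using assms by (simp add: success_ending_sum_def failure_ending_sum_def sum.distrib del: sum.cl_ivl_Suc)
qed

theorem theorem7p1:
  fixes q \<theta> :: real and M :: "'a measure" and X :: "nat \<Rightarrow> 'a \<Rightarrow> nat" and k1 k2 n :: nat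
  assumes "0 \<le> \<theta>" and "\<theta> \<le> 1" and "0 < q" and "q < 1"
    and "q_bernoulli_process q \<theta> M X"
    and "k1 \<ge> 1" and "k2 \<ge> 1" and "n \<ge> 1"
  shows "\<P>(\<omega> in M. longest_run 1 (\<lambda>j. X j \<omega>) n \<le> k1 \<and> longest_run 0 (\<lambda>j. X j \<omega>) n \<le> k2)
    = (\<Sum>i=1..n. \<theta> ^ (n - i) * (\<Prod>j=1..i. 1 - \<theta> * q ^ (j - 1)) *
         (\<Sum>s=1..i. D_sum q (k1 + 1) (k2 + 1) (int n - int i) (int i) s
                  + A_sum q (k1 + 1) (k2 + 1) (int n - int i) (int i) s
                  + C_sum q (k1 + 1) (k2 + 1) (int n - int i) (int i) (s + 1)
                  + B_sum q (k1 + 1) (k2 + 1) (int n - int i) (int i) s))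
      + eta n k1 * \<theta> ^ n"
proof -
  interpret prob_space M
    using assms(5) by (simp add: q_bernoulli_process_def)
  interpret q_bernoulli M X q \<theta>
    by unfold_locales (rule assms(5))
  let ?k = "\<lambda>v. if v = 1 then k1 else k2"
  let ?p = "\<lambda>i. prob (event (bounded_runs ?k 0 n i)) + prob (event (bounded_runs ?k 1 n i))"
  have p: "?p i = base_weight n i *
      (success_ending_sum q (Suc k1) (Suc k2) i (int n - int i) (int i) +
       failure_ending_sum q (Suc k1) (Suc k2) i (int n - int i) (int i))" for i
    using prob_bounded_runs[of i i ?k n] by (simp add: distrib_left)
  have "\<P>(\<omega> in M. longest_run 1 (\<lambda>j. X j \<omega>) n \<le> k1 \<and> longest_run 0 (\<lambda>j. X j \<omega>) n \<le> k2) = (\<Sum>i\<le>n. ?p i)"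
    using prob_longest_runs[OF assms(8), of ?k] by simp
  also have "\<dots> = ?p 0 + (\<Sum>i=1..n. ?p i)"
    by (simp add: atMost_atLeast0 sum.atLeast_Suc_atMost)
  also have "?p 0 = eta n k1 * \<theta> ^ n"
    unfolding p using ending_sums_no_failures[OF assms(8)] by (simp add: base_weight_def)
  also have "(\<Sum>i=1..n. ?p i) = (\<Sum>i=1..n. \<theta> ^ (n - i) * (\<Prod>j=1..i. 1 - \<theta> * q ^ (j - 1)) *
         (\<Sum>s=1..i. D_sum q (k1 + 1) (k2 + 1) (int n - int i) (int i) s
                  + A_sum q (k1 + 1) (k2 + 1) (int n - int i) (int i) s
                  + C_sum q (k1 + 1) (k2 + 1) (int n - int i) (int i) (s + 1)
                  + B_sum q (k1 + 1) (k2 + 1) (int n - int i) (int i) s))"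
  proof (rule sum.cong[OF refl])
    fix i assume "i \<in> {1..n}"
    then have "int i > 0" by simp
    moreover have "base_weight n i = \<theta> ^ (n - i) * (\<Prod>j=1..i. 1 - \<theta> * q ^ (j - 1))"
      unfolding base_weight_def One_nat_def prod.atLeast1_atMost_eq by simp
    ultimately show "?p i = \<theta> ^ (n - i) * (\<Prod>j=1..i. 1 - \<theta> * q ^ (j - 1)) *
         (\<Sum>s=1..i. D_sum q (k1 + 1) (k2 + 1) (int n - int i) (int i) s
                  + A_sum q (k1 + 1) (k2 + 1) (int n - int i) (int i) s
                  + C_sum q (k1 + 1) (k2 + 1) (int n - int i) (int i) (s + 1)
                  + B_sum q (k1 + 1) (k2 + 1) (int n - int i) (int i) s)"
      unfolding p ending_sums_some_failure[OF \<open>int i > 0\<close>] by (simp only: Suc_eq_plus1)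
  qed
  finally show ?thesis by (simp only: add.commute)
qed

end
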